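(* For every $k\in\mathbb{N}$ there is a constant $C>0$ depending only on $k$ such that the following holds. Let $p$ be a prime with $k<p$, let $U$ be a finite-dimensional vector space over $\mathbb{F}_p$, let $c>0$, and let $Q: U \to \mathbb{F}_p$ be a polynomial of degree $k$ with $\operatorname{bias} \mathcal{L}_Q \geq c$. Let $\varepsilon > 0$. Then there exist a nonnegative integer $m \leq (\varepsilon c/2)^{-C}$, coefficients $c_1, \dots, c_m \in \mathbb{C}$ with $\sum_{i \in [m]} |c_i| \leq c^{-1}$, and polynomials $R_1, \dots, R_m : U \to \mathbb{F}_p$ of degree at most $k-1$ such that \[\Big\| \chi \circ Q - \sum_{i \in [m]} c_i \chi \circ R_i\Big\|_{L^2} \leq \varepsilon.\]
   Context: $\chi(a)=\exp(2\pi ia/p)$. $\mathcal{L}_Q(b_1,\dots,b_k)=(k!)^{-1}\Delta_{b_1}\cdots\Delta_{b_k}Q(x)$ is the symmetric multilinear form on $U^k$ associated with $Q$ (independent of $x$), where $\Delta_bF(x)=F(x+b)-F(x)$; $\operatorname{bias}\mathcal{L}_Q = |U|^{-k}\sum_{b_1,\dots,b_k\in U}\chi(\mathcal{L}_Q(b_1,\dots,b_k))$. For $f:U\to\mathbb{C}$, $\|f\|_{L^2}=\big(\frac{1}{|U|}\sum_{x\in U}|f(x)|^2\big)^{1/2}$. *)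

theory Defs
  imports
    "HOL-Analysis.Analysis"
    "HOL-Library.Complex_Order"
    "HOL-Number_Theory.Residues"
    "Jordan_Normal_Form.Missing_VectorSpace"
begin

text \<open>
  The field with \<open>p\<close> elements is \<open>residue_ring (int p)\<close>, with carrier \<open>{0..p-1}\<close>, and vector
  spaces are records with an explicit carrier. Hence \<open>p\<close> and the space \<open>U\<close> are values, not types,
  and can be quantified below a constant that must not depend on them. The type of the vectors is
  no obstacle to uniformity either: every finite vector space has an isomorphic copy whose carrier
  is a set of natural numbers, so a constant that serves the vector type \<open>nat\<close> serves all spaces.
\<close>

abbreviation prime_field :: "nat \<Rightarrow> int ring"
  where "prime_field p \<equiv> residue_ring (int p)"

definition chi :: "nat \<Rightarrow> int \<Rightarrow> complex"
  where "chi p a = exp (2 * of_real pi * \<i> * of_int a / of_nat p)"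

text \<open>
  \<open>F\<close> is a polynomial function of degree at most \<open>d\<close> if, in the coordinates given by a finite basis
  \<open>B\<close>, it is a linear combination of the monomials \<open>\<Prod>b\<in>B. x b ^ \<alpha> b\<close> of total degree at most \<open>d\<close>.
  The choice of basis is immaterial. The bound \<open>d\<close> is an integer, so that degree at most \<open>-1\<close> makes
  sense and characterises the zero function.
\<close>

definition poly_degree_le ::
    "('k, 'r) ring_scheme \<Rightarrow> ('k, 'a, 'v) module_scheme \<Rightarrow> int \<Rightarrow> ('a \<Rightarrow> 'k) \<Rightarrow> bool"
  where "poly_degree_le K U d F \<longleftrightarrow>
    (\<exists>B a. finite B \<and> vectorspace.basis K U B \<and> a \<in> UNIV \<rightarrow> carrier K \<and>
      (\<forall>x \<in> B \<rightarrow> carrier K.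
        F (module.lincomb U x B) =
          (\<Oplus>\<^bsub>K\<^esub>\<alpha> \<in> {\<alpha> \<in> B \<rightarrow>\<^sub>E (UNIV :: nat set). int (\<Sum>b\<in>B. \<alpha> b) \<le> d}.
            a \<alpha> \<otimes>\<^bsub>K\<^esub> (\<Otimes>\<^bsub>K\<^esub>b\<in>B. x b [^]\<^bsub>K\<^esub> \<alpha> b))))"

definition poly_degree_eq ::
    "('k, 'r) ring_scheme \<Rightarrow> ('k, 'a, 'v) module_scheme \<Rightarrow> int \<Rightarrow> ('a \<Rightarrow> 'k) \<Rightarrow> bool"
  where "poly_degree_eq K U d F \<longleftrightarrow>
    poly_degree_le K U d F \<and> \<not> poly_degree_le K U (d - 1) F"

definition difference ::
    "('k, 'r) ring_scheme \<Rightarrow> ('k, 'a, 'v) module_scheme \<Rightarrow> 'a \<Rightarrow> ('a \<Rightarrow> 'k) \<Rightarrow> 'a \<Rightarrow> 'k"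
  where "difference K U b F = (\<lambda>x. F (x \<oplus>\<^bsub>U\<^esub> b) \<ominus>\<^bsub>K\<^esub> F x)"

text \<open>
  The argument \<open>bs\<close> is the tuple \<open>[b\<^sub>1, \<dots>, b\<^sub>k]\<close>. For \<open>Q\<close> of degree at most \<open>k\<close> the \<open>k\<close>-fold
  difference is a constant function; it is evaluated at the origin. The factor \<open>k!\<close> is inverted in
  the field \<open>K\<close>.
\<close>

definition multilinear_form ::
    "('k, 'r) ring_scheme \<Rightarrow> ('k, 'a, 'v) module_scheme \<Rightarrow> nat \<Rightarrow> ('a \<Rightarrow> 'k) \<Rightarrow> 'a list \<Rightarrow> 'k"
  where "multilinear_form K U k Q bs =
    inv\<^bsub>K\<^esub> ([(fact k :: nat)] \<cdot>\<^bsub>K\<^esub> \<one>\<^bsub>K\<^esub>) \<otimes>\<^bsub>K\<^esub> foldr (difference K U) bs Q \<zero>\<^bsub>U\<^esub>"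

definition bias ::
    "nat \<Rightarrow> (int, 'a, 'v) module_scheme \<Rightarrow> nat \<Rightarrow> ('a list \<Rightarrow> int) \<Rightarrow> complex"
  where "bias p U k L =
    (\<Sum>bs \<in> {bs. set bs \<subseteq> carrier U \<and> length bs = k}. chi p (L bs)) / of_nat (card (carrier U) ^ k)"

definition L2_norm_on :: "'a set \<Rightarrow> ('a \<Rightarrow> complex) \<Rightarrow> real"
  where "L2_norm_on A f = sqrt ((\<Sum>x\<in>A. (cmod (f x))\<^sup>2) / real (card A))"

end

theory Submission
  imports Defs
begin

text \<open>
  By translation invariance, for every \<open>x\<close> the bias is the average over \<open>b\<^sub>1, \<dots>, b\<^sub>k\<close> of
  \<open>\<chi> (L (x - b\<^sub>1, \<dots>, x - b\<^sub>k))\<close>. For fixed \<open>b\<^sub>i\<close> the argument is \<open>Q x - R\<^sub>b x\<close> with \<open>R\<^sub>b\<close> of degree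
  at most \<open>k - 1\<close>, because the \<open>k\<close>-th difference of \<open>s ^ k\<close> is \<open>k!\<close>. As the bias is real,
  \<open>\<chi> \<circ> Q\<close> equals the average of \<open>bias\<^sup>-\<^sup>1 (\<chi> \<circ> R\<^sub>b)\<close> exactly. An average of functions bounded by
  \<open>1 / c\<close> is within \<open>1 / (c \<surd>m)\<close> in \<open>L\<^sup>2\<close> of the mean of \<open>m\<close> suitable ones, which can be picked
  one at a time: averaged over the next choice, the squared error of the unnormalised sum grows by
  at most \<open>c\<^sup>-\<^sup>2\<close>.
  Hence \<open>C = 2\<close> works for all \<open>k\<close>.
\<close>

section \<open>Greedy approximation of averages\<close>

text \<open>Some index does no worse than the average over \<open>A\<close>. The increments
  \<open>g i x - f x\<close> average to 0, so the cross term with \<open>E x\<close> vanishes, and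
  their mean square is at most \<open>M\<^sup>2\<close>.\<close>

lemma greedy_approximation_step:
  fixes g :: "'i \<Rightarrow> 'x \<Rightarrow> complex" and f E :: "'x \<Rightarrow> complex" and M :: real
  assumes A: "finite A" "A \<noteq> {}" and X: "finite X"
    and f: "\<And>x. x \<in> X \<Longrightarrow> f x * of_nat (card A) = (\<Sum>i\<in>A. g i x)"
    and M: "\<And>i x. i \<in> A \<Longrightarrow> x \<in> X \<Longrightarrow> cmod (g i x) \<le> M"
  shows "\<exists>i\<in>A. (\<Sum>x\<in>X. (cmod (E x + g i x - f x))\<^sup>2) \<le> (\<Sum>x\<in>X. (cmod (E x))\<^sup>2) + M\<^sup>2 * card X"
proof (rule ccontr)
  assume "\<not> ?thesis"
  then have "(\<Sum>i\<in>A. (\<Sum>x\<in>X. (cmod (E x))\<^sup>2) + M\<^sup>2 * card X)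
      < (\<Sum>i\<in>A. \<Sum>x\<in>X. (cmod (E x + g i x - f x))\<^sup>2)"
    using A by (intro sum_strict_mono) (auto simp: not_le)
  also have "\<dots> = (\<Sum>x\<in>X. \<Sum>i\<in>A. (cmod (E x + g i x - f x))\<^sup>2)"
    by (rule sum.swap)
  also have "\<dots> \<le> (\<Sum>x\<in>X. card A * (cmod (E x))\<^sup>2 + card A * M\<^sup>2)"
  proof (rule sum_mono)
    fix x assume x: "x \<in> X"
    define u where "u = E x - f x"
    have "(\<Sum>i\<in>A. (cmod (E x + g i x - f x))\<^sup>2)
        = (\<Sum>i\<in>A. (cmod u)\<^sup>2 + 2 * (u \<bullet> g i x) + (cmod (g i x))\<^sup>2)"
    proof (rule sum.cong[OF refl])
      fix i
      have "E x + g i x - f x = u + g i x" by (simp add: u_def)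
      then show "(cmod (E x + g i x - f x))\<^sup>2 = (cmod u)\<^sup>2 + 2 * (u \<bullet> g i x) + (cmod (g i x))\<^sup>2"
        by (simp only: power2_norm_eq_inner) (simp add: inner_add_left inner_add_right inner_commute)
    qed
    also have "\<dots> = card A * (cmod u)\<^sup>2 + 2 * (u \<bullet> (\<Sum>i\<in>A. g i x)) + (\<Sum>i\<in>A. (cmod (g i x))\<^sup>2)"
      by (simp add: sum.distrib inner_sum_right sum_distrib_left)
    also have "(\<Sum>i\<in>A. g i x) = real (card A) *\<^sub>R f x"
      using f[OF x] by (simp add: scaleR_conv_of_real mult.commute)
    \<comment> \<open>As \<open>u + f x = E x\<close>, this is the identity |u|^2 + 2 u.f = |u +
      f|^2 - |f|^2; the negative term in \<open>f x\<close> is dropped next.\<close>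
    also have "card A * (cmod u)\<^sup>2 + 2 * (u \<bullet> (real (card A) *\<^sub>R f x))
        = card A * ((cmod (E x))\<^sup>2 - (cmod (f x))\<^sup>2)"
      unfolding u_def power2_norm_eq_inner
      by (simp add: inner_diff_left inner_diff_right inner_commute algebra_simps)
    also have "\<dots> + (\<Sum>i\<in>A. (cmod (g i x))\<^sup>2) \<le> card A * (cmod (E x))\<^sup>2 + (\<Sum>i\<in>A. M\<^sup>2)"
      using M x by (intro add_mono sum_mono power_mono mult_left_mono) auto
    finally show "(\<Sum>i\<in>A. (cmod (E x + g i x - f x))\<^sup>2) \<le> card A * (cmod (E x))\<^sup>2 + card A * M\<^sup>2"
      by simp
  qed
  also have "\<dots> = (\<Sum>i\<in>A. (\<Sum>x\<in>X. (cmod (E x))\<^sup>2) + M\<^sup>2 * card X)"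
    by (simp add: sum.distrib sum_distrib_left algebra_simps)
  finally show False by simp
qed

text \<open>The squared error starts at 0 and gains at most \<open>M\<^sup>2 * card X\<close> with
  each choice. It is thus linear in \<open>n\<close>, while passing to the mean divides it by the
  square of \<open>n\<close>. Indices may repeat.\<close>

lemma greedy_approximation:
  fixes g :: "'i \<Rightarrow> 'x \<Rightarrow> complex" and f :: "'x \<Rightarrow> complex" and M :: real
  assumes A: "finite A" "A \<noteq> {}" and X: "finite X"
    and f: "\<And>x. x \<in> X \<Longrightarrow> f x * of_nat (card A) = (\<Sum>i\<in>A. g i x)"
    and M: "\<And>i x. i \<in> A \<Longrightarrow> x \<in> X \<Longrightarrow> cmod (g i x) \<le> M"
  shows "\<exists>s. (\<forall>j\<in>{1..n}. s j \<in> A) \<and>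
    (\<Sum>x\<in>X. (cmod ((\<Sum>j\<in>{1..n}. g (s j) x) - of_nat n * f x))\<^sup>2) \<le> n * M\<^sup>2 * card X"
proof (induction n)
  case (Suc n)
  then obtain s where s: "\<forall>j\<in>{1..n}. s j \<in> A"
    "(\<Sum>x\<in>X. (cmod ((\<Sum>j\<in>{1..n}. g (s j) x) - of_nat n * f x))\<^sup>2) \<le> n * M\<^sup>2 * card X"
    by blast
  define E where "E x = (\<Sum>j\<in>{1..n}. g (s j) x) - of_nat n * f x" for x
  obtain i where i: "i \<in> A"
    "(\<Sum>x\<in>X. (cmod (E x + g i x - f x))\<^sup>2) \<le> (\<Sum>x\<in>X. (cmod (E x))\<^sup>2) + M\<^sup>2 * card X"
    using greedy_approximation_step[of A X f g M E, OF A X f M] by blast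
  define s' where "s' = s(Suc n := i)"
  have "(\<Sum>j\<in>{1..Suc n}. g (s' j) x) - of_nat (Suc n) * f x = E x + g i x - f x" for x
  proof -
    have "(\<Sum>j\<in>{1..n}. g (s' j) x) = (\<Sum>j\<in>{1..n}. g (s j) x)"
      by (intro sum.cong) (auto simp: s'_def)
    then show ?thesis by (simp add: E_def s'_def algebra_simps)
  qed
  moreover have "\<forall>j\<in>{1..Suc n}. s' j \<in> A"
    using s(1) i(1) by (auto simp: s'_def)
  moreover have "(\<Sum>x\<in>X. (cmod (E x + g i x - f x))\<^sup>2) \<le> Suc n * M\<^sup>2 * card X"
    using i(2) s(2) by (simp add: E_def algebra_simps)
  ultimately show ?case by (intro exI[of _ s']) simp
qed auto

section \<open>The character\<close>

lemma chi_add: "chi p (a + b) = chi p a * chi p b"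
  by (simp add: chi_def exp_add[symmetric] add_divide_distrib[symmetric] algebra_simps)

lemma norm_chi [simp]: "cmod (chi p a) = 1"
proof -
  have "chi p a = exp (\<i> * of_real (2 * pi * of_int a / of_nat p))"
    by (simp add: chi_def field_simps)
  then show ?thesis by (simp only: norm_exp_i_times)
qed

lemma cnj_chi: "cnj (chi p a) = chi p (- a)"
  by (simp add: chi_def exp_cnj)

lemma chi_multiple:
  assumes "p > 0"
  shows "chi p (int p * a) = 1"
proof -
  have "chi p (int p * a) = exp ((2 * of_int a * pi) * \<i>)"
    using assms by (simp add: chi_def field_simps)
  also have "\<dots> = 1" by (rule exp_integer_2pi) simp
  finally show ?thesis .
qed

lemma chi_cong:
  assumes "p > 0" "[a = b] (mod int p)"
  shows "chi p a = chi p b"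
proof -
  obtain t where t: "a = b + int p * t"
    using assms(2) by (metis cong_iff_lin cong_sym)
  then show ?thesis using chi_multiple[OF assms(1), of t] by (simp add: chi_add)
qed

section \<open>Iterated differences of powers\<close>

text \<open>Differencing a polynomial at \<open>s z + v\<close> in the direction
  \<open>z - w\<close> raises \<open>s\<close> by one, so its leading coefficient
  \<open>s ^ k\<close> gets differenced in the integer variable \<open>s\<close>.\<close>

definition forward_diff :: "(int \<Rightarrow> int) \<Rightarrow> int \<Rightarrow> int"
  where "forward_diff g s = g (s + 1) - g s"

lemma forward_diff_pow_sum:
  "(forward_diff ^^ n) (\<lambda>s. \<Sum>i\<in>A. c i * g i s) = (\<lambda>s. \<Sum>i\<in>A. c i * (forward_diff ^^ n) (g i) s)"
  by (induction n) (auto simp: forward_diff_def fun_eq_iff sum_subtractf[symmetric] algebra_simps)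

lemma forward_diff_power:
  "forward_diff (\<lambda>s. s ^ j) = (\<lambda>s. \<Sum>i<j. int (j choose i) * s ^ i)"
proof
  fix s :: int
  have "(s + 1) ^ j = (\<Sum>i\<le>j. int (j choose i) * s ^ i)"
    by (simp add: binomial_ring)
  also have "\<dots> = (\<Sum>i<j. int (j choose i) * s ^ i) + s ^ j"
    by (simp add: lessThan_Suc_atMost[symmetric])
  finally show "forward_diff (\<lambda>s. s ^ j) s = (\<Sum>i<j. int (j choose i) * s ^ i)"
    by (simp add: forward_diff_def)
qed

lemma forward_diff_pow_power:
  "j \<le> n \<Longrightarrow> (forward_diff ^^ n) (\<lambda>s. s ^ j) s = (if j = n then fact n else 0)"
proof (induction n arbitrary: j)
  case (Suc n)
  have "(forward_diff ^^ Suc n) (\<lambda>s. s ^ j) s = (\<Sum>i<j. int (j choose i) * (forward_diff ^^ n) (\<lambda>s. s ^ i) s)"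
    by (simp only: funpow_Suc_right o_apply forward_diff_power forward_diff_pow_sum)
  \<comment> \<open>By the induction hypothesis only \<open>i = n\<close> survives. It occurs just
    when \<open>j = Suc n\<close>, where
    \<open>(Suc n choose n) * fact n = fact (Suc n)\<close>.\<close>
  also have "\<dots> = (\<Sum>i<j. if i = n then int (j choose i) * fact n else 0)"
    using Suc by (intro sum.cong) auto
  also have "\<dots> = (if j = Suc n then fact (Suc n) else 0)"
    using Suc.prems by (auto simp: sum.delta)
  finally show ?case .
qed simp

section \<open>Polynomials modulo \<open>p\<close>\<close>

definition exponents :: "'a set \<Rightarrow> int \<Rightarrow> ('a \<Rightarrow> nat) set"
  where "exponents B d = {\<alpha> \<in> B \<rightarrow>\<^sub>E UNIV. int (\<Sum>b\<in>B. \<alpha> b) \<le> d}"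

text \<open>The congruence ranges over all integer vectors, not only reduced ones, so ordinary
  integer algebra applies. For negative \<open>d\<close> the sum is empty and \<open>f\<close>
  vanishes modulo \<open>p\<close>.\<close>

definition poly_mod :: "int \<Rightarrow> 'a set \<Rightarrow> int \<Rightarrow> (('a \<Rightarrow> int) \<Rightarrow> int) \<Rightarrow> bool"
  where "poly_mod p B d f \<longleftrightarrow>
    (\<exists>a. \<forall>z. [f z = (\<Sum>\<alpha>\<in>exponents B d. a \<alpha> * (\<Prod>b\<in>B. z b ^ \<alpha> b))] (mod p))"

lemma finite_exponents:
  assumes "finite B"
  shows "finite (exponents B d)"
proof (rule finite_subset)
  show "exponents B d \<subseteq> B \<rightarrow>\<^sub>E {..nat d}"
  proof
    fix \<alpha> assume a: "\<alpha> \<in> exponents B d"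
    have "\<alpha> b \<le> nat d" if "b \<in> B" for b
    proof -
      have "\<alpha> b \<le> (\<Sum>b\<in>B. \<alpha> b)"
        using assms that by (intro member_le_sum) auto
      then show ?thesis using a by (auto simp: exponents_def simp del: of_nat_sum)
    qed
    then show "\<alpha> \<in> B \<rightarrow>\<^sub>E {..nat d}" using a by (auto simp: exponents_def PiE_iff)
  qed
qed (use assms in \<open>auto intro: finite_PiE\<close>)

lemma poly_mod_cong:
  assumes "poly_mod p B d f" "\<And>z. [g z = f z] (mod p)"
  shows "poly_mod p B d g"
  using assms unfolding poly_mod_def by (meson cong_trans)

lemma poly_mod_0: "poly_mod p B d (\<lambda>_. 0)"
  unfolding poly_mod_def by (intro exI[of _ "\<lambda>_. 0"]) simp

lemma poly_mod_add:
  assumes "poly_mod p B d f" "poly_mod p B d g"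
  shows "poly_mod p B d (\<lambda>z. f z + g z)"
proof -
  obtain a where a: "\<And>z. [f z = (\<Sum>\<alpha>\<in>exponents B d. a \<alpha> * (\<Prod>b\<in>B. z b ^ \<alpha> b))] (mod p)"
    using assms(1) unfolding poly_mod_def by blast
  obtain a' where a': "\<And>z. [g z = (\<Sum>\<alpha>\<in>exponents B d. a' \<alpha> * (\<Prod>b\<in>B. z b ^ \<alpha> b))] (mod p)"
    using assms(2) unfolding poly_mod_def by blast
  show ?thesis unfolding poly_mod_def
    by (rule exI[of _ "\<lambda>\<alpha>. a \<alpha> + a' \<alpha>"])
      (use cong_add[OF a a'] in \<open>simp add: distrib_right sum.distrib\<close>)
qed

lemma poly_mod_scale:
  assumes "poly_mod p B d f"
  shows "poly_mod p B d (\<lambda>z. c * f z)"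
proof -
  obtain a where a: "\<And>z. [f z = (\<Sum>\<alpha>\<in>exponents B d. a \<alpha> * (\<Prod>b\<in>B. z b ^ \<alpha> b))] (mod p)"
    using assms(1) unfolding poly_mod_def by blast
  show ?thesis unfolding poly_mod_def
    by (rule exI[of _ "\<lambda>\<alpha>. c * a \<alpha>"])
      (use cong_scalar_left[OF a] in \<open>simp add: sum_distrib_left mult.assoc\<close>)
qed

lemma poly_mod_diff:
  assumes "poly_mod p B d f" "poly_mod p B d g"
  shows "poly_mod p B d (\<lambda>z. f z - g z)"
  using poly_mod_add[OF assms(1) poly_mod_scale[OF assms(2), of "-1"]] by simp

lemma poly_mod_sum:
  assumes "\<And>i. i \<in> A \<Longrightarrow> poly_mod p B d (f i)"
  shows "poly_mod p B d (\<lambda>z. \<Sum>i\<in>A. f i z)"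
  using assms by (induction A rule: infinite_finite_induct) (auto intro: poly_mod_0 poly_mod_add)

lemma poly_mod_monomial:
  assumes "finite B" "int (\<Sum>b\<in>B. \<alpha> b) \<le> d"
  shows "poly_mod p B d (\<lambda>z. \<Prod>b\<in>B. z b ^ \<alpha> b)"
proof -
  \<comment> \<open>Members of \<open>exponents\<close> are extensional, so \<open>\<alpha>\<close>
    is represented by its restriction; the coefficients are the indicator of that point.\<close>
  have mem: "restrict \<alpha> B \<in> exponents B d"
    using assms by (auto simp: exponents_def)
  have "(\<Prod>b\<in>B. z b ^ \<alpha> b) = (\<Prod>b\<in>B. z b ^ restrict \<alpha> B b)" for z :: "'a \<Rightarrow> int"
    by (intro prod.cong) auto
  also have "\<dots> z = (\<Sum>\<beta>\<in>exponents B d. if \<beta> = restrict \<alpha> B then \<Prod>b\<in>B. z b ^ \<beta> b else 0)" for z :: "'a \<Rightarrow> int"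
    using mem finite_exponents[OF assms(1)] by (simp add: sum.delta)
  also have "\<dots> z = (\<Sum>\<beta>\<in>exponents B d. of_bool (\<beta> = restrict \<alpha> B) * (\<Prod>b\<in>B. z b ^ \<beta> b))" for z :: "'a \<Rightarrow> int"
    by (intro sum.cong) auto
  finally show ?thesis
    unfolding poly_mod_def by (intro exI[of _ "\<lambda>\<beta>. of_bool (\<beta> = restrict \<alpha> B)"]) simp
qed

lemma poly_mod_mono:
  assumes "finite B" "poly_mod p B d f" "d \<le> d'"
  shows "poly_mod p B d' f"
proof -
  obtain a where a: "\<And>z. [f z = (\<Sum>\<alpha>\<in>exponents B d. a \<alpha> * (\<Prod>b\<in>B. z b ^ \<alpha> b))] (mod p)"
    using assms(2) unfolding poly_mod_def by blast
  have "poly_mod p B d' (\<lambda>z. \<Sum>\<alpha>\<in>exponents B d. a \<alpha> * (\<Prod>b\<in>B. z b ^ \<alpha> b))"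
    using assms(1,3)
    by (intro poly_mod_sum poly_mod_scale poly_mod_monomial) (auto simp: exponents_def)
  then show ?thesis using a by (rule poly_mod_cong)
qed

lemma poly_mod_coord_mult:
  assumes "finite B" "poly_mod p B d f" "i \<in> B"
  shows "poly_mod p B (d + 1) (\<lambda>z. z i * f z)"
proof -
  obtain a where a: "\<And>z. [f z = (\<Sum>\<alpha>\<in>exponents B d. a \<alpha> * (\<Prod>b\<in>B. z b ^ \<alpha> b))] (mod p)"
    using assms(2) unfolding poly_mod_def by blast
  have shift: "z i * (\<Prod>b\<in>B. z b ^ \<alpha> b) = (\<Prod>b\<in>B. z b ^ (\<alpha>(i := Suc (\<alpha> i))) b)"
    for z :: "'a \<Rightarrow> int" and \<alpha>
    using assms(1,3) by (simp add: prod.remove[of B i])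
  have deg: "(\<Sum>b\<in>B. (\<alpha>(i := Suc (\<alpha> i))) b) = Suc (\<Sum>b\<in>B. \<alpha> b)" for \<alpha> :: "'a \<Rightarrow> nat"
    using assms(1,3) by (simp add: sum.remove[of B i])
  have "poly_mod p B (d + 1)
      (\<lambda>z. \<Sum>\<alpha>\<in>exponents B d. a \<alpha> * (\<Prod>b\<in>B. z b ^ (\<alpha>(i := Suc (\<alpha> i))) b))"
    by (intro poly_mod_sum poly_mod_scale poly_mod_monomial[OF assms(1)], unfold deg)
      (auto simp: exponents_def)
  moreover have "[z i * f z = (\<Sum>\<alpha>\<in>exponents B d. a \<alpha> * (\<Prod>b\<in>B. z b ^ (\<alpha>(i := Suc (\<alpha> i))) b))] (mod p)" for z
    using cong_scalar_left[OF a, of "z i" z]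
    by (simp only: sum_distrib_left mult.left_commute[of "z i"] shift)
  ultimately show ?thesis by (rule poly_mod_cong)
qed

text \<open>Here \<open>g z\<close> plays the role of \<open>f (s z + v)\<close>: the top degree parts differ by the factor \<open>s ^ n\<close>.\<close>

definition dilates :: "int \<Rightarrow> 'a set \<Rightarrow> int \<Rightarrow> nat \<Rightarrow> (('a \<Rightarrow> int) \<Rightarrow> int) \<Rightarrow> (('a \<Rightarrow> int) \<Rightarrow> int) \<Rightarrow> bool"
  where "dilates p B s n f g \<longleftrightarrow>
    poly_mod p B (int n) f \<and> poly_mod p B (int n - 1) (\<lambda>z. g z - s ^ n * f z)"

lemma dilates_imp_poly_mod:
  assumes "finite B" "dilates p B s n f g"
  shows "poly_mod p B (int n) g"
  using poly_mod_add[OF poly_mod_mono[OF assms(1), of p "int n - 1"] poly_mod_scale, of _ "int n" f "s ^ n"] assms(2)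
  unfolding dilates_def by force

text \<open>The new error is \<open>s * (z i * (g z - s ^ n * f z)) + v i * g z\<close>, and both
  summands have degree at most \<open>n\<close>.\<close>

lemma dilates_coord_mult:
  assumes B: "finite B" "i \<in> B" and fg: "dilates p B s n f g"
  shows "dilates p B s (Suc n) (\<lambda>z. z i * f z) (\<lambda>z. (s * z i + v i) * g z)"
proof -
  have "poly_mod p B (int n) (\<lambda>z. s * (z i * (g z - s ^ n * f z)) + v i * g z)"
    using poly_mod_coord_mult[OF B(1) _ B(2), of p "int n - 1"] fg dilates_imp_poly_mod[OF B(1) fg]
    by (intro poly_mod_add poly_mod_scale) (auto simp: dilates_def)
  then have "poly_mod p B (int n) (\<lambda>z. (s * z i + v i) * g z - s ^ Suc n * (z i * f z))"
    by (rule poly_mod_cong) (simp add: algebra_simps)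
  moreover have "poly_mod p B (int n + 1) (\<lambda>z. z i * f z)"
    using poly_mod_coord_mult[OF B(1) _ B(2)] fg by (auto simp: dilates_def)
  ultimately show ?thesis by (simp add: dilates_def add.commute)
qed

lemma dilates_power_mult:
  assumes "finite B" "i \<in> B" "dilates p B s n f g"
  shows "dilates p B s (m + n) (\<lambda>z. z i ^ m * f z) (\<lambda>z. (s * z i + v i) ^ m * g z)"
proof (induction m)
  case (Suc m)
  show ?case using dilates_coord_mult[OF assms(1,2) Suc, of v] by (simp add: mult.assoc)
qed (use assms in simp)

lemma dilates_monomial:
  assumes "finite B" "A \<subseteq> B"
  shows "dilates p B s (\<Sum>b\<in>A. \<alpha> b) (\<lambda>z. \<Prod>b\<in>A. z b ^ \<alpha> b) (\<lambda>z. \<Prod>b\<in>A. (s * z b + v b) ^ \<alpha> b)"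
proof -
  have "finite A" using assms finite_subset by blast
  then show ?thesis using assms(2)
  proof (induction A)
    case empty
    \<comment> \<open>The error of the empty product is \<open>1 - 1 = 0\<close>, which meets the
      degree bound \<open>-1\<close>.\<close>
    show ?case using poly_mod_monomial[OF assms(1), of "\<lambda>_. 0" 0 p] poly_mod_0
      by (simp add: dilates_def)
  next
    case (insert i A)
    then show ?case
      using dilates_power_mult[OF assms(1), of i p s _ _ _ "\<alpha> i" v] by simp
  qed
qed

lemma poly_mod_substitution:
  assumes B: "finite B" and q: "poly_mod p B (int k) q"
  shows "poly_mod p B (int k - 1) (\<lambda>z. q (\<lambda>b. s * z b + v b) - s ^ k * q z)"
proof -
  obtain a where a: "\<And>z. [q z = (\<Sum>\<alpha>\<in>exponents B (int k). a \<alpha> * (\<Prod>b\<in>B. z b ^ \<alpha> b))] (mod p)"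
    using q unfolding poly_mod_def by blast
  have mono: "poly_mod p B (int k - 1) (\<lambda>z. (\<Prod>b\<in>B. (s * z b + v b) ^ \<alpha> b) - s ^ k * (\<Prod>b\<in>B. z b ^ \<alpha> b))"
    if "\<alpha> \<in> exponents B (int k)" for \<alpha>
  proof (cases "(\<Sum>b\<in>B. \<alpha> b) = k")
    case True
    then show ?thesis using dilates_monomial[OF B subset_refl, of p s \<alpha> v] by (simp add: dilates_def)
  next
    case False
    then have deg: "int (\<Sum>b\<in>B. \<alpha> b) \<le> int k - 1" using that by (auto simp: exponents_def simp del: of_nat_sum)
    \<comment> \<open>Below the top degree both terms already have degree at most
      \<open>k - 1\<close>, so it is harmless that \<open>s ^ k\<close> is not the factor by which
      this monomial scales.\<close>
    show ?thesis
      using dilates_imp_poly_mod[OF B dilates_monomial[OF B subset_refl, of p s \<alpha> v]]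
        poly_mod_monomial[OF B deg] poly_mod_mono[OF B _ deg]
      by (intro poly_mod_diff poly_mod_scale) blast+
  qed
  have "poly_mod p B (int k - 1) (\<lambda>z. \<Sum>\<alpha>\<in>exponents B (int k).
      a \<alpha> * ((\<Prod>b\<in>B. (s * z b + v b) ^ \<alpha> b) - s ^ k * (\<Prod>b\<in>B. z b ^ \<alpha> b)))"
    by (intro poly_mod_sum poly_mod_scale mono)
  then show ?thesis
  proof (rule poly_mod_cong)
    fix z
    show "[q (\<lambda>b. s * z b + v b) - s ^ k * q z = (\<Sum>\<alpha>\<in>exponents B (int k).
        a \<alpha> * ((\<Prod>b\<in>B. (s * z b + v b) ^ \<alpha> b) - s ^ k * (\<Prod>b\<in>B. z b ^ \<alpha> b)))] (mod p)"
      using cong_diff[OF a[of "\<lambda>b. s * z b + v b"] cong_scalar_left[OF a[of z], of "s ^ k"]]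
      by (simp add: sum_subtractf sum_distrib_left right_diff_distrib mult.left_commute)
  qed
qed

section \<open>Coordinates with respect to a basis\<close>

text \<open>Coordinates are unreduced integers, so that \<open>from_coords\<close> turns pointwise integer addition into
  addition in \<open>U\<close> and polynomials can be handled as integer expressions modulo \<open>p\<close>.\<close>

definition from_coords :: "nat \<Rightarrow> (int, 'a) module \<Rightarrow> 'a set \<Rightarrow> ('a \<Rightarrow> int) \<Rightarrow> 'a"
  where "from_coords p U B z = module.lincomb U (\<lambda>b. z b mod int p) B"

text \<open>One basis is fixed throughout: the one witnessing the degree of \<open>Q\<close> also
  witnesses the degrees of the approximating polynomials, so no change of basis occurs.\<close>

locale prime_field_basis =
  fixes p :: nat and U :: "(int, 'a) module" (structure) and B :: "'a set"
  assumes prime: "prime p"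
    and vectorspace: "vectorspace (prime_field p) U"
    and finite_basis: "finite B"
    and basis: "vectorspace.basis (prime_field p) U B"
begin

interpretation K: residues "int p" "prime_field p"
  by unfold_locales (use prime prime_gt_1_nat in auto)

interpretation V: vectorspace "prime_field p" U
  by (rule vectorspace)

lemma p_pos: "p > 0"
  using prime prime_gt_0_nat by blast

lemma basis_carrier: "B \<subseteq> carrier U"
  using basis by (auto simp: V.basis_def)

lemma mod_p_cong: "[x mod int p = x] (mod int p)"
  by (simp add: cong_def)

lemma coords_mod_closed: "(\<lambda>b. z b mod int p) \<in> B \<rightarrow> carrier (prime_field p)"
  by auto

abbreviation coords ("\<phi>") where "\<phi> \<equiv> from_coords p U B"

lemma from_coords_closed [simp]: "\<phi> z \<in> carrier U"
  using V.lincomb_closed[OF basis_carrier coords_mod_closed] by (simp add: from_coords_def)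

lemma from_coords_add: "\<phi> z \<oplus> \<phi> w = \<phi> (\<lambda>b. z b + w b)"
  using V.lincomb_sum[OF finite_basis basis_carrier coords_mod_closed coords_mod_closed, of z w]
  by (simp add: from_coords_def K.add_cong)

lemma from_coords_diff: "\<phi> z \<ominus> \<phi> w = \<phi> (\<lambda>b. z b - w b)"
proof -
  have "\<phi> (\<lambda>b. z b - w b) \<oplus> \<phi> w = \<phi> z"
    by (simp add: from_coords_add)
  then have "\<phi> z \<ominus> \<phi> w = (\<phi> (\<lambda>b. z b - w b) \<oplus> \<phi> w) \<oplus> \<ominus> \<phi> w"
    by (simp add: V.M.minus_eq)
  also have "\<dots> = \<phi> (\<lambda>b. z b - w b)"
    by (simp add: V.M.a_assoc V.M.r_neg)
  finally show ?thesis .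
qed

lemma from_coords_0: "\<phi> (\<lambda>_. 0) = \<zero>"
  using from_coords_diff[of "\<lambda>_. 0" "\<lambda>_. 0"] by (simp add: V.M.minus_eq V.M.r_neg)

lemma lincomb_eq_from_coords:
  assumes "x \<in> B \<rightarrow> carrier (prime_field p)"
  shows "V.lincomb x B = \<phi> x"
  unfolding from_coords_def using assms
  by (intro V.lincomb_cong[OF refl basis_carrier]) (auto simp: K.res_carrier_eq Pi_iff)

lemma carrier_eq_lincombs: "carrier U = (\<lambda>x. V.lincomb x B) ` (B \<rightarrow> carrier (prime_field p))"
  using basis V.finite_span[OF finite_basis basis_carrier] by (auto simp: V.basis_def)

lemma from_coords_surj:
  assumes "u \<in> carrier U"
  shows "\<exists>z. \<phi> z = u"
  using assms unfolding carrier_eq_lincombs by (auto simp: lincomb_eq_from_coords)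

lemma finite_carrier: "finite (carrier U)"
proof (rule finite_subset)
  show "carrier U \<subseteq> \<phi> ` (B \<rightarrow>\<^sub>E carrier (prime_field p))"
  proof
    fix u assume "u \<in> carrier U"
    then obtain x where x: "x \<in> B \<rightarrow> carrier (prime_field p)" "u = V.lincomb x B"
      unfolding carrier_eq_lincombs by auto
    have "V.lincomb x B = V.lincomb (restrict x B) B"
      using x(1) by (intro V.lincomb_cong[OF refl basis_carrier]) auto
    moreover have "restrict x B \<in> B \<rightarrow>\<^sub>E carrier (prime_field p)"
      using x(1) by auto
    ultimately show "u \<in> \<phi> ` (B \<rightarrow>\<^sub>E carrier (prime_field p))"
      using x(2) lincomb_eq_from_coords[of "restrict x B"] by (metis PiE_iff Pi_iff image_eqI)
  qed
qed (use finite_basis in \<open>auto intro: finite_PiE\<close>)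

section \<open>Passing between polynomials over the field and integer polynomials modulo
  \<open>p\<close>\<close>

lemma prime_field_polynomial:
  assumes x: "x \<in> B \<rightarrow> carrier (prime_field p)"
  shows "(\<Oplus>\<^bsub>prime_field p\<^esub>\<alpha> \<in> exponents B d.
      a \<alpha> \<otimes>\<^bsub>prime_field p\<^esub> (\<Otimes>\<^bsub>prime_field p\<^esub>b\<in>B. x b [^]\<^bsub>prime_field p\<^esub> \<alpha> b))
    = (\<Sum>\<alpha>\<in>exponents B d. a \<alpha> * (\<Prod>b\<in>B. x b ^ \<alpha> b)) mod int p"
proof -
  \<comment> \<open>Each field operation reduces modulo \<open>p\<close>; these reductions are
    collected into a single one at the end.\<close>
  have "a \<alpha> \<otimes>\<^bsub>prime_field p\<^esub> (\<Otimes>\<^bsub>prime_field p\<^esub>b\<in>B. x b [^]\<^bsub>prime_field p\<^esub> \<alpha> b)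
      = (a \<alpha> * (\<Prod>b\<in>B. x b ^ \<alpha> b)) mod int p" for \<alpha>
  proof -
    have "x b [^]\<^bsub>prime_field p\<^esub> \<alpha> b = x b ^ \<alpha> b mod int p" if "b \<in> B" for b
      using K.pow_cong[of "x b" "\<alpha> b"] x that by (auto simp: K.res_carrier_eq Pi_iff)
    then have "(\<Otimes>\<^bsub>prime_field p\<^esub>b\<in>B. x b [^]\<^bsub>prime_field p\<^esub> \<alpha> b)
        = (\<Otimes>\<^bsub>prime_field p\<^esub>b\<in>B. x b ^ \<alpha> b mod int p)"
      by (intro K.finprod_cong') auto
    then show ?thesis
      using K.prod_cong[OF finite_basis] by (simp add: K.res_mult_eq mod_mult_right_eq)
  qed
  then show ?thesis using K.sum_cong[OF finite_exponents[OF finite_basis]] by simp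
qed

lemma poly_degree_leI:
  assumes F: "F \<in> carrier U \<rightarrow> carrier (prime_field p)"
    and poly: "poly_mod (int p) B d (\<lambda>z. F (\<phi> z))"
  shows "poly_degree_le (prime_field p) U d F"
proof -
  obtain a where a: "\<And>z. [F (\<phi> z) = (\<Sum>\<alpha>\<in>exponents B d. a \<alpha> * (\<Prod>b\<in>B. z b ^ \<alpha> b))] (mod int p)"
    using poly unfolding poly_mod_def by blast
  have "F (V.lincomb x B) = (\<Oplus>\<^bsub>prime_field p\<^esub>\<alpha> \<in> exponents B d.
      (a \<alpha> mod int p) \<otimes>\<^bsub>prime_field p\<^esub> (\<Otimes>\<^bsub>prime_field p\<^esub>b\<in>B. x b [^]\<^bsub>prime_field p\<^esub> \<alpha> b))"
    if x: "x \<in> B \<rightarrow> carrier (prime_field p)" for x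
  proof -
    have "F (\<phi> x) \<in> {0..int p - 1}"
      using F by (auto simp: Pi_iff K.res_carrier_eq[symmetric])
    \<comment> \<open>Values of \<open>F\<close> are reduced, so a congruence modulo
      \<open>p\<close> determines them.\<close>
    then have "F (\<phi> x) = F (\<phi> x) mod int p" by simp
    also have "\<dots> = (\<Sum>\<alpha>\<in>exponents B d. a \<alpha> * (\<Prod>b\<in>B. x b ^ \<alpha> b)) mod int p"
      using a[of x] by (simp add: cong_def)
    \<comment> \<open>The coefficients are reduced because \<open>poly_degree_le\<close> wants them
      in the carrier of the field.\<close>
    also have "\<dots> = (\<Sum>\<alpha>\<in>exponents B d. (a \<alpha> mod int p) * (\<Prod>b\<in>B. x b ^ \<alpha> b)) mod int p"
      unfolding cong_def[symmetric] by (intro cong_sum cong_mult cong_refl cong_sym[OF mod_p_cong])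
    finally show ?thesis
      unfolding prime_field_polynomial[OF x] lincomb_eq_from_coords[OF x] .
  qed
  then show ?thesis
    unfolding poly_degree_le_def exponents_def using finite_basis basis
    by (intro exI[of _ B] exI[of _ "\<lambda>\<alpha>. a \<alpha> mod int p"]) auto
qed

lemma poly_modI:
  assumes F: "\<And>x. x \<in> B \<rightarrow> carrier (prime_field p) \<Longrightarrow>
      F (V.lincomb x B) = (\<Oplus>\<^bsub>prime_field p\<^esub>\<alpha> \<in> exponents B d.
        a \<alpha> \<otimes>\<^bsub>prime_field p\<^esub> (\<Otimes>\<^bsub>prime_field p\<^esub>b\<in>B. x b [^]\<^bsub>prime_field p\<^esub> \<alpha> b))"
  shows "poly_mod (int p) B d (\<lambda>z. F (\<phi> z))"
proof -
  have "[F (\<phi> z) = (\<Sum>\<alpha>\<in>exponents B d. a \<alpha> * (\<Prod>b\<in>B. z b ^ \<alpha> b))] (mod int p)" for z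
  proof -
    let ?S = "\<lambda>z. \<Sum>\<alpha>\<in>exponents B d. a \<alpha> * (\<Prod>b\<in>B. z b ^ \<alpha> b)"
    have "F (\<phi> z) = ?S (\<lambda>b. z b mod int p) mod int p"
      using F[OF coords_mod_closed] prime_field_polynomial[OF coords_mod_closed]
      by (simp add: from_coords_def)
    \<comment> \<open>The representation of \<open>F\<close> speaks of reduced coordinates; an
      integer polynomial has the same residue at \<open>z\<close>.\<close>
    moreover have "[?S (\<lambda>b. z b mod int p) = ?S z] (mod int p)"
      by (intro cong_sum cong_mult cong_refl cong_prod cong_pow mod_p_cong)
    ultimately show ?thesis by (simp add: cong_def)
  qed
  then show ?thesis unfolding poly_mod_def by blast
qed

section \<open>Iterated differences of a polynomial on \<open>U\<close>\<close>

lemma difference_cong: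
  "[difference (prime_field p) U b F x = F (x \<oplus> b) - F x] (mod int p)"
  by (simp add: difference_def K.minus_eq K.res_neg_eq K.res_add_eq cong_def mod_simps)

text \<open>Induction on \<open>ws\<close> with \<open>s\<close> and \<open>v\<close> free. The
  directions \<open>z - w\<close> depend on \<open>z\<close>, but a step along one takes
  \<open>s z + v\<close> to \<open>(s + 1) z + (v - w)\<close>, a point of the same form. The base
  case is \<open>poly_mod_substitution\<close>.\<close>

lemma poly_mod_iterated_difference:
  assumes Q: "poly_mod (int p) B (int k) (\<lambda>z. Q (\<phi> z))"
  shows "poly_mod (int p) B (int k - 1)
    (\<lambda>z. foldr (difference (prime_field p) U) (map (\<lambda>w. \<phi> (\<lambda>b. z b - w b)) ws) Q (\<phi> (\<lambda>b. s * z b + v b))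
      - (forward_diff ^^ length ws) (\<lambda>s. s ^ k) s * Q (\<phi> z))"
proof (induction ws arbitrary: s v)
  case Nil
  show ?case using poly_mod_substitution[OF finite_basis Q, of s v] by simp
next
  case (Cons w ws)
  define G where "G z = foldr (difference (prime_field p) U) (map (\<lambda>w. \<phi> (\<lambda>b. z b - w b)) ws) Q" for z
  define g where "g = (forward_diff ^^ length ws) (\<lambda>s. s ^ k)"
  \<comment> \<open>This is the induction hypothesis at \<open>s + 1\<close>, \<open>v - w\<close>
    minus the one at \<open>s\<close>, \<open>v\<close>.\<close>
  have "poly_mod (int p) B (int k - 1)
    (\<lambda>z. (G z (\<phi> (\<lambda>b. (s + 1) * z b + (v b - w b))) - g (s + 1) * Q (\<phi> z))
      - (G z (\<phi> (\<lambda>b. s * z b + v b)) - g s * Q (\<phi> z)))"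
    unfolding G_def g_def by (intro poly_mod_diff Cons)
  then show ?case
  proof (rule poly_mod_cong)
    fix z
    have "\<phi> (\<lambda>b. s * z b + v b) \<oplus> \<phi> (\<lambda>b. z b - w b) = \<phi> (\<lambda>b. (s + 1) * z b + (v b - w b))"
      unfolding from_coords_add by (simp add: algebra_simps)
    then have "[difference (prime_field p) U (\<phi> (\<lambda>b. z b - w b)) (G z) (\<phi> (\<lambda>b. s * z b + v b))
        = G z (\<phi> (\<lambda>b. (s + 1) * z b + (v b - w b))) - G z (\<phi> (\<lambda>b. s * z b + v b))] (mod int p)"
      using difference_cong[of "\<phi> (\<lambda>b. z b - w b)" "G z" "\<phi> (\<lambda>b. s * z b + v b)"] by simp
    from cong_diff[OF this cong_refl[of "forward_diff g s * Q (\<phi> z)"]]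
    show "[foldr (difference (prime_field p) U) (map (\<lambda>w. \<phi> (\<lambda>b. z b - w b)) (w # ws)) Q
            (\<phi> (\<lambda>b. s * z b + v b)) - (forward_diff ^^ length (w # ws)) (\<lambda>s. s ^ k) s * Q (\<phi> z)
        = (G z (\<phi> (\<lambda>b. (s + 1) * z b + (v b - w b))) - g (s + 1) * Q (\<phi> z))
          - (G z (\<phi> (\<lambda>b. s * z b + v b)) - g s * Q (\<phi> z))] (mod int p)"
      by (simp add: G_def[symmetric] g_def[symmetric] forward_diff_def algebra_simps)
  qed
qed

section \<open>Division by \<open>k!\<close> and the residual polynomials\<close>

lemma add_pow_one: "[(n::nat)] \<cdot>\<^bsub>prime_field p\<^esub> \<one>\<^bsub>prime_field p\<^esub> = int n mod int p"
proof (induction n)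
  case (Suc n)
  then show ?case
    by (simp add: K.add.nat_pow_Suc K.res_add_eq K.res_one_eq mod_simps add.commute)
qed (simp add: K.res_zero_eq)

text \<open>As \<open>k < p\<close>, the prime \<open>p\<close> does not divide \<open>k!\<close>,
  which is therefore a unit.\<close>

lemma inverse_fact:
  assumes "k < p"
  shows "[inv\<^bsub>prime_field p\<^esub> ([(fact k :: nat)] \<cdot>\<^bsub>prime_field p\<^esub> \<one>\<^bsub>prime_field p\<^esub>) * fact k = 1] (mod int p)"
proof -
  have "coprime (fact k) p"
    using assms prime by (metis coprime_commute not_less prime_dvd_fact_iff prime_imp_coprime)
  then have "coprime (int (fact k)) (int p)"
    by (simp only: coprime_int_iff)
  then have "int (fact k) mod int p \<in> Units (prime_field p)"
    using K.mod_in_res_units K.m_gt_one by blast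
  from K.Units_l_inv[OF this] K.m_gt_one show ?thesis
    unfolding add_pow_one by (simp add: K.res_mult_eq K.res_one_eq cong_def mod_simps)
qed

text \<open>This is \<open>R\<^sub>b\<close> of the overview, reduced so that its values lie in the
  carrier.\<close>

definition residual :: "nat \<Rightarrow> ('a \<Rightarrow> int) \<Rightarrow> 'a list \<Rightarrow> 'a \<Rightarrow> int"
  where "residual k Q bs u =
    (Q u - multilinear_form (prime_field p) U k Q (map (\<lambda>b. u \<ominus> b) bs)) mod int p"

lemma residual_closed: "residual k Q bs \<in> carrier U \<rightarrow> carrier (prime_field p)"
  by (simp add: residual_def)

lemma residual_degree:
  assumes k: "k < p" and Q: "poly_mod (int p) B (int k) (\<lambda>z. Q (\<phi> z))"
    and bs: "set bs \<subseteq> carrier U" "length bs = k"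
  shows "poly_degree_le (prime_field p) U (int k - 1) (residual k Q bs)"
proof (rule poly_degree_leI[OF residual_closed])
  \<comment> \<open>Arbitrarily chosen integer coordinates of the entries of
    \<open>bs\<close>.\<close>
  define ws where "ws = map (\<lambda>b. SOME z. \<phi> z = b) bs"
  define I where "I = inv\<^bsub>prime_field p\<^esub> ([(fact k :: nat)] \<cdot>\<^bsub>prime_field p\<^esub> \<one>\<^bsub>prime_field p\<^esub>)"
  define D where "D z = foldr (difference (prime_field p) U) (map (\<lambda>w. \<phi> (\<lambda>b. z b - w b)) ws) Q \<zero>" for z
  have "\<phi> (SOME z. \<phi> z = b) = b" if "b \<in> set bs" for b
    using someI_ex[OF from_coords_surj] that bs(1) by blast
  then have bs_eq: "bs = map \<phi> ws"
    by (auto simp: ws_def intro!: map_idI[symmetric])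
  have "(forward_diff ^^ length ws) (\<lambda>s. s ^ k) 0 = fact k"
    using bs(2) by (simp add: bs_eq forward_diff_pow_power)
  \<comment> \<open>Taking \<open>s = 0\<close> and \<open>v = 0\<close> puts the base point at the
    origin, where \<open>multilinear_form\<close> is evaluated; modulo lower degree
    \<open>D z\<close> is then \<open>fact k * Q (\<phi> z)\<close>.\<close>
  then have "poly_mod (int p) B (int k - 1) (\<lambda>z. - I * (D z - fact k * Q (\<phi> z)))"
    using poly_mod_iterated_difference[OF Q, of ws 0 "\<lambda>_. 0"]
    by (intro poly_mod_scale) (simp add: D_def from_coords_0)
  then show "poly_mod (int p) B (int k - 1) (\<lambda>z. residual k Q bs (\<phi> z))"
  proof (rule poly_mod_cong)
    fix z
    have "[residual k Q bs (\<phi> z) = Q (\<phi> z) - I * D z] (mod int p)"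
      by (simp add: residual_def multilinear_form_def bs_eq comp_def from_coords_diff
          D_def[symmetric] I_def[symmetric] K.res_mult_eq cong_def mod_simps)
    also have "[Q (\<phi> z) - I * D z = (I * fact k) * Q (\<phi> z) - I * D z] (mod int p)"
      using cong_diff[OF cong_scalar_right[OF inverse_fact[OF k], of "Q (\<phi> z)"] cong_refl[of "I * D z"]]
      by (simp add: I_def cong_sym)
    also have "(I * fact k) * Q (\<phi> z) - I * D z = - I * (D z - fact k * Q (\<phi> z))"
      by (simp add: algebra_simps)
    finally show "[residual k Q bs (\<phi> z) = - I * (D z - fact k * Q (\<phi> z))] (mod int p)" .
  qed
qed

section \<open>The exact averaging identity\<close>

lemma sum_chi_residual:
  fixes \<beta> :: real
  assumes \<beta>: "bias p U k (multilinear_form (prime_field p) U k Q) = of_real \<beta>" and u: "u \<in> carrier U"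
  defines "T \<equiv> {bs. set bs \<subseteq> carrier U \<and> length bs = k}"
  shows "chi p (Q u) * of_real \<beta> * of_nat (card T) = (\<Sum>bs\<in>T. chi p (residual k Q bs u))"
proof -
  let ?L = "multilinear_form (prime_field p) U k Q"
  have ne: "carrier U \<noteq> {}" using u by auto
  have card: "card T = card (carrier U) ^ k"
    unfolding T_def by (rule card_lists_length_eq[OF finite_carrier])
  \<comment> \<open>For fixed \<open>u\<close>, the map \<open>b \<mapsto> u \<ominus> b\<close> is
    an involution of the carrier, so applying it to each entry permutes \<open>T\<close>.\<close>
  have inv: "u \<ominus> (u \<ominus> b) = b" if "b \<in> carrier U" for b
    using u that by (simp add: V.M.minus_eq V.M.minus_add V.M.a_assoc[symmetric] V.M.r_neg)
  have inv_map: "map (\<lambda>b. u \<ominus> b) (map (\<lambda>b. u \<ominus> b) bs) = bs" if "bs \<in> T" for bs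
    using that inv by (auto simp: T_def intro!: map_idI)
  have map_T: "map (\<lambda>b. u \<ominus> b) bs \<in> T" if "bs \<in> T" for bs
    using that u by (auto simp: T_def)
  have "(\<Sum>bs\<in>T. chi p (?L bs)) = (\<Sum>bs\<in>T. chi p (?L (map (\<lambda>b. u \<ominus> b) bs)))"
    by (rule sum.reindex_bij_witness[where i = "map (\<lambda>b. u \<ominus> b)" and j = "map (\<lambda>b. u \<ominus> b)"])
      (simp_all only: inv_map map_T)
  also have "\<dots> = (\<Sum>bs\<in>T. chi p (Q u) * cnj (chi p (residual k Q bs u)))"
  proof (rule sum.cong[OF refl])
    fix bs
    have "[?L (map (\<lambda>b. u \<ominus> b) bs) = Q u + - residual k Q bs u] (mod int p)"
      by (simp add: residual_def cong_def mod_simps)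
    from chi_cong[OF p_pos this]
    show "chi p (?L (map (\<lambda>b. u \<ominus> b) bs)) = chi p (Q u) * cnj (chi p (residual k Q bs u))"
      by (simp only: chi_add cnj_chi)
  qed
  also have "\<dots> = chi p (Q u) * cnj (\<Sum>bs\<in>T. chi p (residual k Q bs u))"
    by (simp add: sum_distrib_left)
  finally have "of_real \<beta> * of_nat (card T) = chi p (Q u) * cnj (\<Sum>bs\<in>T. chi p (residual k Q bs u))"
    using \<beta> ne finite_carrier unfolding bias_def card T_def[symmetric] by (simp add: field_simps)
  \<comment> \<open>Conjugation fixes the left side, because \<open>\<beta>\<close> is real, and
    removes the conjugate from the sum over residuals.\<close>
  then have "cnj (of_real \<beta> * of_nat (card T)) = cnj (chi p (Q u)) * (\<Sum>bs\<in>T. chi p (residual k Q bs u))"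
    by simp
  then have "chi p (Q u) * of_real \<beta> * of_nat (card T)
      = (chi p (Q u) * cnj (chi p (Q u))) * (\<Sum>bs\<in>T. chi p (residual k Q bs u))"
    by simp
  then show ?thesis by (simp add: complex_norm_square[symmetric])
qed

section \<open>Sampling the average\<close>

lemma approximation_by_lower_degree:
  fixes c \<epsilon> :: real
  assumes k: "k < p" and Q: "poly_mod (int p) B (int k) (\<lambda>z. Q (\<phi> z))"
    and c: "c > 0" "complex_of_real c \<le> bias p U k (multilinear_form (prime_field p) U k Q)"
    and \<epsilon>: "\<epsilon> > 0"
  shows "\<exists>(m::nat) (coef :: nat \<Rightarrow> complex) (R :: nat \<Rightarrow> 'a \<Rightarrow> int).
        real m \<le> (\<epsilon> * c / 2) powr (- 2) \<and>
        (\<Sum>i\<in>{1..m}. cmod (coef i)) \<le> 1 / c \<and>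
        (\<forall>i\<in>{1..m}. R i \<in> carrier U \<rightarrow> carrier (prime_field p) \<and>
          poly_degree_le (prime_field p) U (int k - 1) (R i)) \<and>
        L2_norm_on (carrier U)
          (\<lambda>x. chi p (Q x) - (\<Sum>i\<in>{1..m}. coef i * chi p (R i x))) \<le> \<epsilon>"
proof -
  define T where "T = {bs. set bs \<subseteq> carrier U \<and> length bs = k}"
  define N where "N = card (carrier U)"
  have fin_T: "finite T"
    unfolding T_def by (rule finite_lists_length_eq[OF finite_carrier])
  have N: "N > 0"
    using finite_carrier V.M.zero_closed by (auto simp: N_def card_gt_0_iff)
  have card_T: "card T = N ^ k"
    unfolding T_def N_def by (rule card_lists_length_eq[OF finite_carrier])
  then have T_pos: "card T > 0" using N by simp
  then have T_ne: "T \<noteq> {}" by auto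
  define \<beta> where "\<beta> = Re (bias p U k (multilinear_form (prime_field p) U k Q))"
  \<comment> \<open>The order on complex numbers requires equal imaginary parts, so the lower bound
    \<open>c\<close> forces the bias to be real.\<close>
  have bias_eq: "bias p U k (multilinear_form (prime_field p) U k Q) = of_real \<beta>"
    and c_le: "c \<le> \<beta>"
    using c(2) by (auto simp: less_eq_complex_def \<beta>_def complex_eq_iff)
  have \<beta>_pos: "\<beta> > 0" using c_le c(1) by simp
  \<comment> \<open>Together with \<open>c \<le> \<beta>\<close> this gives
    \<open>c \<le> 1\<close>, from which \<open>t \<ge> 1\<close> will follow.\<close>
  have "\<beta> \<le> 1"
  proof -
    have "\<beta> = cmod (bias p U k (multilinear_form (prime_field p) U k Q))"
      using \<beta>_pos by (simp add: bias_eq)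
    also have "\<dots> = cmod (\<Sum>bs\<in>T. chi p (multilinear_form (prime_field p) U k Q bs)) / card T"
      by (simp add: bias_def T_def[symmetric] N_def[symmetric] card_T norm_divide norm_power)
    also have "\<dots> \<le> (\<Sum>bs\<in>T. cmod (chi p (multilinear_form (prime_field p) U k Q bs))) / card T"
      by (intro divide_right_mono norm_sum) auto
    finally show ?thesis using T_pos by simp
  qed
  show ?thesis
  proof (cases "\<epsilon> \<ge> 1")
    case True
    \<comment> \<open>The empty sum suffices: its error has norm exactly 1, as \<open>chi\<close>
      has modulus 1.\<close>
    have "L2_norm_on (carrier U) (\<lambda>x. chi p (Q x)) = 1"
      using N by (simp add: L2_norm_on_def N_def)
    then show ?thesis using True c by (intro exI[of _ 0]) simp
  next
    case False
    \<comment> \<open>A mean of \<open>m\<close> samples has error at most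
      \<open>1 / (c * sqrt m)\<close>, which is at most \<open>\<epsilon>\<close> once
      \<open>m \<ge> t\<close>.\<close>
    define t where "t = 1 / (c * \<epsilon>)\<^sup>2"
    have c\<epsilon>: "0 < c * \<epsilon>" "c * \<epsilon> \<le> 1"
      using c \<epsilon> False \<open>\<beta> \<le> 1\<close> c_le mult_mono[of c 1 \<epsilon> 1] by auto
    have t: "t \<ge> 1"
      using c\<epsilon> power_le_one[of "c * \<epsilon>" 2] unfolding t_def
      by (metis less_imp_le le_divide_eq_1_pos zero_less_power)
    define m where "m = nat \<lceil>t\<rceil>"
    have m_ge: "real m \<ge> t" unfolding m_def by (rule real_nat_ceiling_ge)
    then have m_pos: "m > 0" using t by (cases m) auto
    have "real m \<le> t + 1" using t by (simp add: m_def)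
    \<comment> \<open>As \<open>t \<ge> 1\<close>, the factor 4 gained from halving
      \<open>\<epsilon> * c\<close> in the bound on \<open>m\<close> pays for rounding
      \<open>t\<close> up.\<close>
    also have "\<dots> \<le> 4 * t" using t by simp
    also have "\<dots> = (\<epsilon> * c / 2) powr (- 2)"
      using c\<epsilon> c \<epsilon> by (simp add: t_def powr_minus powr_numeral power_mult_distrib power_divide field_simps)
    finally have m_le: "real m \<le> (\<epsilon> * c / 2) powr (- 2)" .
    \<comment> \<open>Dividing by the exact bias \<open>\<beta>\<close>, rather than by
      \<open>c\<close>, makes the mean equal to \<open>chi p (Q x)\<close>.\<close>
    define g where "g bs x = chi p (residual k Q bs x) / of_real \<beta>" for bs x
    have mean: "chi p (Q x) * of_nat (card T) = (\<Sum>bs\<in>T. g bs x)" if "x \<in> carrier U" for x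
      using sum_chi_residual[OF bias_eq that] \<beta>_pos
      by (simp add: T_def[symmetric] g_def sum_divide_distrib[symmetric] field_simps)
    have bound: "cmod (g bs x) \<le> 1 / \<beta>" for bs x
      using \<beta>_pos by (simp add: g_def norm_divide)
    obtain s where s: "\<forall>j\<in>{1..m}. s j \<in> T"
      and err: "(\<Sum>x\<in>carrier U. (cmod ((\<Sum>j\<in>{1..m}. g (s j) x) - of_nat m * chi p (Q x)))\<^sup>2)
        \<le> m * (1 / \<beta>)\<^sup>2 * N"
      using greedy_approximation[of T "carrier U" "\<lambda>x. chi p (Q x)" g "1 / \<beta>" m,
          OF fin_T T_ne finite_carrier mean bound] by (auto simp: N_def)
    \<comment> \<open>Equal weights whose moduli sum to \<open>1 / \<beta>\<close>, which is at most
      \<open>1 / c\<close>; repeated choices keep separate indices.\<close>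
    define coef where "coef i = 1 / (of_real \<beta> * of_nat m :: complex)" for i :: nat
    have diff: "chi p (Q x) - (\<Sum>i\<in>{1..m}. coef i * chi p (residual k Q (s i) x))
        = - (((\<Sum>j\<in>{1..m}. g (s j) x) - of_nat m * chi p (Q x)) / of_nat m)" for x
      using m_pos \<beta>_pos
      by (simp add: coef_def g_def sum_divide_distrib[symmetric] sum_distrib_left[symmetric] diff_divide_distrib)
    have "(\<Sum>x\<in>carrier U. (cmod (chi p (Q x) - (\<Sum>i\<in>{1..m}. coef i * chi p (residual k Q (s i) x))))\<^sup>2)
        = (\<Sum>x\<in>carrier U. (cmod ((\<Sum>j\<in>{1..m}. g (s j) x) - of_nat m * chi p (Q x)))\<^sup>2) / (real m)\<^sup>2"
      unfolding diff by (simp add: norm_divide power_divide sum_divide_distrib)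
    also have "\<dots> \<le> (m * (1 / \<beta>)\<^sup>2 * N) / (real m)\<^sup>2"
      using err by (rule divide_right_mono) simp
    also have "\<dots> = N * ((1 / \<beta>)\<^sup>2 / m)"
      using m_pos by (simp add: power2_eq_square)
    \<comment> \<open>Here \<open>\<beta>\<close> is weakened to \<open>c\<close> and
      \<open>m\<close> to \<open>t\<close>, whose value makes the bound exactly
      \<open>\<epsilon>\<^sup>2\<close>.\<close>
    also have "\<dots> \<le> N * ((1 / c)\<^sup>2 / t)"
      using c_le c(1) m_ge t by (intro mult_left_mono frac_le power_mono) (auto intro: divide_left_mono)
    also have "(1 / c)\<^sup>2 / t = \<epsilon>\<^sup>2"
      using c(1) by (simp add: t_def power2_eq_square)
    finally have "L2_norm_on (carrier U)
        (\<lambda>x. chi p (Q x) - (\<Sum>i\<in>{1..m}. coef i * chi p (residual k Q (s i) x))) \<le> \<epsilon>"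
      unfolding L2_norm_on_def using N \<epsilon>
      by (intro real_le_lsqrt) (simp_all add: N_def field_simps)
    moreover have "(\<Sum>i\<in>{1..m}. cmod (coef i)) \<le> 1 / c"
      using m_pos \<beta>_pos c c_le by (simp add: coef_def norm_divide norm_mult frac_le)
    moreover have "\<forall>i\<in>{1..m}. residual k Q (s i) \<in> carrier U \<rightarrow> carrier (prime_field p) \<and>
        poly_degree_le (prime_field p) U (int k - 1) (residual k Q (s i))"
      using s residual_closed residual_degree[OF k Q] by (auto simp: T_def)
    ultimately show ?thesis
      using m_le by (intro exI[of _ m] exI[of _ coef] exI[of _ "\<lambda>i. residual k Q (s i)"]) blast
  qed
qed

end

section \<open>The uniform statement, with exponent 2 for every \<open>k\<close>\<close>

theorem theorem6:
  fixes k :: nat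
  shows "\<exists>C::real. C > 0 \<and>
    (\<forall>(p::nat) (U :: (int, 'a) module) (c::real) (Q :: 'a \<Rightarrow> int) (\<epsilon>::real).
      prime p \<and> k < p \<and>
      vectorspace (prime_field p) U \<and> vectorspace.fin_dim (prime_field p) U \<and>
      c > 0 \<and>
      Q \<in> carrier U \<rightarrow> carrier (prime_field p) \<and>
      poly_degree_eq (prime_field p) U (int k) Q \<and>
      complex_of_real c \<le> bias p U k (multilinear_form (prime_field p) U k Q) \<and>
      \<epsilon> > 0 \<longrightarrow>
      (\<exists>(m::nat) (coef :: nat \<Rightarrow> complex) (R :: nat \<Rightarrow> 'a \<Rightarrow> int).
        real m \<le> (\<epsilon> * c / 2) powr (- C) \<and>
        (\<Sum>i\<in>{1..m}. cmod (coef i)) \<le> 1 / c \<and>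
        (\<forall>i\<in>{1..m}. R i \<in> carrier U \<rightarrow> carrier (prime_field p) \<and>
          poly_degree_le (prime_field p) U (int k - 1) (R i)) \<and>
        L2_norm_on (carrier U)
          (\<lambda>x. chi p (Q x) - (\<Sum>i\<in>{1..m}. coef i * chi p (R i x))) \<le> \<epsilon>))"
proof (intro exI[of _ "2::real"] conjI allI impI; (elim conjE)?)
  fix p :: nat and U :: "(int, 'a) module" and c \<epsilon> :: real and Q :: "'a \<Rightarrow> int"
  assume p: "prime p" and k: "k < p" and U: "vectorspace (prime_field p) U"
    and deg: "poly_degree_eq (prime_field p) U (int k) Q"
    and c: "c > 0" "complex_of_real c \<le> bias p U k (multilinear_form (prime_field p) U k Q)"
    and \<epsilon>: "\<epsilon> > 0"
  obtain B a where B: "finite B" "vectorspace.basis (prime_field p) U B"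
    and rep: "\<And>x. x \<in> B \<rightarrow> carrier (prime_field p) \<Longrightarrow>
      Q (module.lincomb U x B) = (\<Oplus>\<^bsub>prime_field p\<^esub>\<alpha> \<in> exponents B (int k).
        a \<alpha> \<otimes>\<^bsub>prime_field p\<^esub> (\<Otimes>\<^bsub>prime_field p\<^esub>b\<in>B. x b [^]\<^bsub>prime_field p\<^esub> \<alpha> b))"
    using deg unfolding poly_degree_eq_def unfolding poly_degree_le_def exponents_def by (elim conjE exE) simp
  interpret prime_field_basis p U B
    by (rule prime_field_basis.intro[OF p U B])
  show "\<exists>(m::nat) (coef :: nat \<Rightarrow> complex) (R :: nat \<Rightarrow> 'a \<Rightarrow> int).
        real m \<le> (\<epsilon> * c / 2) powr (- 2) \<and>
        (\<Sum>i\<in>{1..m}. cmod (coef i)) \<le> 1 / c \<and>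
        (\<forall>i\<in>{1..m}. R i \<in> carrier U \<rightarrow> carrier (prime_field p) \<and>
          poly_degree_le (prime_field p) U (int k - 1) (R i)) \<and>
        L2_norm_on (carrier U)
          (\<lambda>x. chi p (Q x) - (\<Sum>i\<in>{1..m}. coef i * chi p (R i x))) \<le> \<epsilon>"
    by (rule approximation_by_lower_degree[OF k poly_modI[OF rep] c \<epsilon>])
qed simp

end
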